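(* Let $(M_j)_{j\ge1}$ be a sequence of matrices on $\mathbb{C}^d$ that are all contractions for one common norm $|||\cdot|||$ on $\mathbb{C}^d$ and satisfy $M_j\psi_{\mathcal S}=\psi_{\mathcal S}$ for all $j$, where $\psi_{\mathcal S}$ is a fixed vector with $\|\psi_{\mathcal S}\|=1$. Suppose that $$\lim_{n\to\infty}\sup\{\|M_{Q_{j_n}}\cdots M_{Q_{j_1}}\| : j_1,\dots,j_n\in\mathbb{N}^*\}=0.$$ Then $\theta_n$ converges (as $n\to\infty$) if and only if $\psi_n$ does. If they exist, these two limits coincide, and thus $$\lim_{n\to\infty}\Psi_n=|\psi_{\mathcal S}\rangle\langle\psi_\infty|,$$ where $\psi_\infty=\lim_{n\to\infty}\psi_n$. Moreover, $|\psi_{\mathcal S}\rangle\langle\psi_\infty|$ is a projection.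
   Context: Inner products on $\mathbb{C}^d$ are linear in the second factor; $\|\cdot\|$ is the Euclidean norm and the induced operator norm; $|\psi\rangle\langle\phi|$ denotes $\chi\mapsto\langle\phi,\chi\rangle\psi$; $\mathbb{N}^*=\{1,2,\dots\}$. For each $j$ let $P_{1,j}$ be the spectral (Riesz) projection of $M_j$ for the eigenvalue $1$, and set $\psi_j=P_{1,j}^*\psi_{\mathcal S}$, $P_j=|\psi_{\mathcal S}\rangle\langle\psi_j|$ (a projection, as $\langle\psi_j,\psi_{\mathcal S}\rangle=1$), $Q_j=\mathbf{1}-P_j$, $M_{Q_j}=Q_jM_jQ_j$; one has $M_j=P_j+M_{Q_j}$ and $M_j^*\psi_j=\psi_j$. Set $\Psi_n=M_1M_2\cdots M_n$ and $\theta_n=M_n^*M_{n-1}^*\cdots M_2^*\psi_1$ ($\theta_1=\psi_1$). *)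

theory Defs
  imports "HOL-Complex_Analysis.Complex_Analysis"
begin

text \<open>
  Vectors of \<open>\<complex>\<^sup>d\<close> are \<^typ>\<open>complex ^ 'd\<close>, whose library norm is the Euclidean norm; the
  operator norm of a matrix \<open>A\<close> is \<open>onorm ((*v) A)\<close> (the library norm of \<open>A\<close> itself is
  the Frobenius norm, which is only used through the topology it induces).
\<close>

definition cinner :: "complex ^ 'd \<Rightarrow> complex ^ 'd \<Rightarrow> complex" where
  "cinner \<phi> x = (\<Sum>i\<in>UNIV. cnj (\<phi> $ i) * x $ i)"

definition ketbra :: "complex ^ 'd \<Rightarrow> complex ^ 'd \<Rightarrow> complex ^ 'd ^ 'd" where
  "ketbra \<psi> \<phi> = matrix (\<lambda>x. cinner \<phi> x *s \<psi>)"

definition cadjoint :: "complex ^ 'd ^ 'd \<Rightarrow> complex ^ 'd ^ 'd" where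
  "cadjoint A = (\<chi> i j. cnj (A $ j $ i))"

definition is_complex_norm :: "(complex ^ 'd \<Rightarrow> real) \<Rightarrow> bool" where
  "is_complex_norm N \<longleftrightarrow>
     (\<forall>x. 0 \<le> N x) \<and>
     (\<forall>x. N x = 0 \<longleftrightarrow> x = 0) \<and>
     (\<forall>c x. N (c *s x) = cmod c * N x) \<and>
     (\<forall>x y. N (x + y) \<le> N x + N y)"

text \<open>
  The Riesz projection \<open>1/(2\<pi>\<i>) \<ointegral> (z - A)\<^sup>-\<^sup>1 dz\<close>, taken entrywise over all sufficiently
  small circles around \<open>\<mu>\<close>; \<^const>\<open>residue\<close> is by definition this normalised integral.
  Note that \<open>mat z\<close> is \<open>z\<close> times the identity matrix.
\<close>

definition riesz_projection :: "complex ^ 'd ^ 'd \<Rightarrow> complex \<Rightarrow> complex ^ 'd ^ 'd" where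
  "riesz_projection A \<mu> = (\<chi> i j. residue (\<lambda>z. matrix_inv (mat z - A) $ i $ j) \<mu>)"

text \<open>
  The ordered product \<open>A\<^sub>1 A\<^sub>2 \<cdots> A\<^sub>n\<close> of \<open>[A\<^sub>1, \<dots>, A\<^sub>n]\<close>.  (The operation \<open>*\<close> on this type is the
  entrywise product, so \<^const>\<open>prod_list\<close> does not apply.)
\<close>

definition mat_prod_list :: "(complex ^ 'd ^ 'd) list \<Rightarrow> complex ^ 'd ^ 'd" where
  "mat_prod_list As = foldr (**) As (mat 1)"

text \<open>
  In the following, \<open>S\<close> stands for the vector \<open>\<psi>\<^sub>\<S>\<close>, and only the values \<open>M j\<close> with \<open>j \<ge> 1\<close> matter.
\<close>

definition psi_vec ::
  "(nat \<Rightarrow> complex ^ 'd ^ 'd) \<Rightarrow> complex ^ 'd \<Rightarrow> nat \<Rightarrow> complex ^ 'd" where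
  "psi_vec M S j = cadjoint (riesz_projection (M j) 1) *v S"

definition P_mat ::
  "(nat \<Rightarrow> complex ^ 'd ^ 'd) \<Rightarrow> complex ^ 'd \<Rightarrow> nat \<Rightarrow> complex ^ 'd ^ 'd" where
  "P_mat M S j = ketbra S (psi_vec M S j)"

definition Q_mat ::
  "(nat \<Rightarrow> complex ^ 'd ^ 'd) \<Rightarrow> complex ^ 'd \<Rightarrow> nat \<Rightarrow> complex ^ 'd ^ 'd" where
  "Q_mat M S j = mat 1 - P_mat M S j"

definition MQ_mat ::
  "(nat \<Rightarrow> complex ^ 'd ^ 'd) \<Rightarrow> complex ^ 'd \<Rightarrow> nat \<Rightarrow> complex ^ 'd ^ 'd" where
  "MQ_mat M S j = Q_mat M S j ** M j ** Q_mat M S j"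

definition Psi_prod :: "(nat \<Rightarrow> complex ^ 'd ^ 'd) \<Rightarrow> nat \<Rightarrow> complex ^ 'd ^ 'd" where
  "Psi_prod M n = mat_prod_list (map M [1..<Suc n])"

definition theta_vec ::
  "(nat \<Rightarrow> complex ^ 'd ^ 'd) \<Rightarrow> complex ^ 'd \<Rightarrow> nat \<Rightarrow> complex ^ 'd" where
  "theta_vec M S n =
     mat_prod_list (map (\<lambda>j. cadjoint (M j)) (rev [2..<Suc n])) *v psi_vec M S 1"

lemma ketbra_mult_vec: "ketbra \<psi> \<phi> *v x = cinner \<phi> x *s \<psi>"
proof -
  have "cinner \<phi> (axis j 1) = cnj (\<phi> $ j)" for j
    by (simp add: cinner_def axis_def if_distrib[where f = "\<lambda>x. _ * x"] cong: if_cong)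
  then show ?thesis
    by (simp add: vec_eq_iff ketbra_def matrix_def matrix_vector_mult_def cinner_def
        sum_distrib_left mult_ac)
qed

lemma cinner_cadjoint: "cinner (cadjoint A *v \<phi>) x = cinner \<phi> (A *v x)"
proof -
  have "cinner (cadjoint A *v \<phi>) x =
      (\<Sum>i\<in>UNIV. \<Sum>j\<in>UNIV. A $ j $ i * cnj (\<phi> $ j) * x $ i)"
    by (simp add: cinner_def cadjoint_def matrix_vector_mult_def sum_distrib_right)
  also have "\<dots> = (\<Sum>j\<in>UNIV. \<Sum>i\<in>UNIV. A $ j $ i * cnj (\<phi> $ j) * x $ i)"
    by (rule sum.swap)
  also have "\<dots> = cinner \<phi> (A *v x)"
    by (simp add: cinner_def matrix_vector_mult_def sum_distrib_left mult_ac)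
  finally show ?thesis .
qed

end

theory Submission
  imports Defs
begin

text \<open>
  Since the matrices are contractions for a common norm, \<open>(z - 1)(z - M\<^sub>j)\<^sup>-\<^sup>1\<close> stays bounded as
  \<open>z \<down> 1\<close>.  Hence the Riesz projection is the limit of this expression; it is itself a
  contraction, fixes \<open>\<psi>\<^sub>\<S>\<close> and absorbs \<open>M\<^sub>j\<close>, so the \<open>\<psi>\<^sub>j\<close> are uniformly bounded,
  \<open>M\<^sub>j\<^sup>*\<psi>\<^sub>j = \<psi>\<^sub>j\<close> and \<open>\<langle>\<psi>\<^sub>\<S>, \<psi>\<^sub>j\<rangle> = 1\<close>.

  If \<open>\<psi>\<^sub>n \<rightarrow> l\<close>, then \<open>v\<^sub>n = \<theta>\<^sub>n - l\<close> is orthogonal to \<open>\<psi>\<^sub>\<S>\<close> and satisfies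
  \<open>v\<^sub>n\<^sub>+\<^sub>1 = M\<^sub>Q\<^sub>,\<^sub>n\<^sub>+\<^sub>1\<^sup>* v\<^sub>n + e\<^sub>n\<close> with \<open>e\<^sub>n = M\<^sub>n\<^sub>+\<^sub>1\<^sup>* l - l \<rightarrow> 0\<close>.  As long products of the \<open>M\<^sub>Q\<close> have norm at most
  \<open>1/2\<close>, this forces \<open>v\<^sub>n \<rightarrow> 0\<close>.  Conversely, if \<open>\<theta>\<^sub>n \<rightarrow> l\<close>, then \<open>v\<^sub>n = l - \<psi>\<^sub>n\<close> satisfies
  \<open>v\<^sub>n = M\<^sub>Q\<^sub>,\<^sub>n\<^sup>* v\<^sub>n + e\<^sub>n\<close> with \<open>e\<^sub>n = l - M\<^sub>n\<^sup>* l \<rightarrow> 0\<close>, and the same estimate applies to the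
  constant family \<open>M\<^sub>Q\<^sub>,\<^sub>n, M\<^sub>Q\<^sub>,\<^sub>n, \<dots>\<close>.  Finally \<open>\<Psi>\<^sub>n = |\<psi>\<^sub>\<S>\<rangle>\<langle>\<theta>\<^sub>n| + M\<^sub>Q\<^sub>,\<^sub>1 \<cdots> M\<^sub>Q\<^sub>,\<^sub>n\<close>.
\<close>

subsection \<open>Norms on \<open>\<complex>\<^sup>d\<close>\<close>

lemma tendsto_vec_scale:
  fixes x :: "nat \<Rightarrow> complex ^ 'n"
  assumes "a \<longlonglongrightarrow> b" "x \<longlonglongrightarrow> y"
  shows "(\<lambda>n. a n *s x n) \<longlonglongrightarrow> b *s y"
  by (rule vec_tendstoI) (auto intro!: tendsto_intros tendsto_vec_nth assms)

lemma tendsto_matrix_mult_vec: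
  fixes A :: "nat \<Rightarrow> complex ^ 'n ^ 'm"
  assumes "\<And>i j. (\<lambda>n. A n $ i $ j) \<longlonglongrightarrow> B $ i $ j"
  shows "(\<lambda>n. A n *v x) \<longlonglongrightarrow> B *v x"
  by (rule vec_tendstoI) (auto simp: matrix_vector_mult_def intro!: tendsto_intros assms)

lemma complex_norm_neg:
  assumes "is_complex_norm N"
  shows "N (- x) = N x"
proof -
  have "N ((-1) *s x) = cmod (-1) * N x"
    using assms unfolding is_complex_norm_def by blast
  moreover have "(-1) *s x = - x"
    by (simp add: vec_eq_iff)
  ultimately show ?thesis by simp
qed

text \<open>Expand \<open>x\<close> in the standard basis: each coordinate is at most
  \<open>norm x\<close> in modulus.\<close>

lemma complex_norm_le_norm:
  assumes "is_complex_norm N"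
  obtains C where "C > 0" "\<And>x. N x \<le> C * norm x"
proof -
  have N: "\<And>x. 0 \<le> N x" "\<And>c x. N (c *s x) = cmod c * N x" "\<And>x y. N (x + y) \<le> N x + N y" "N 0 = 0"
    using assms unfolding is_complex_norm_def by auto
  \<comment> \<open>The summand 1 makes \<open>C\<close> positive using only that \<open>N\<close>
    is nonnegative on the basis vectors.\<close>
  define C where "C = 1 + (\<Sum>i\<in>UNIV. N (axis i 1))"
  have sum: "N (sum f F) \<le> (\<Sum>i\<in>F. N (f i))" if "finite F" for f :: "'a \<Rightarrow> complex ^ 'a" and F
    using that
  proof (induction F rule: finite_induct)
    case (insert i F)
    then show ?case
      using N(3)[of "f i" "sum f F"] by auto
  qed (simp add: N)
  have "N x \<le> C * norm x" for x
  proof -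
    have "x = (\<Sum>i\<in>UNIV. x $ i *s axis i 1)"
      by (simp add: vec_eq_iff axis_def if_distrib[where f = "\<lambda>x. _ * x"] cong: if_cong)
    then have "N x \<le> (\<Sum>i\<in>UNIV. N (x $ i *s axis i 1))"
      using sum[of UNIV "\<lambda>i. x $ i *s axis i 1"] by simp
    also have "\<dots> \<le> (\<Sum>i\<in>UNIV. norm x * N (axis i 1))"
      by (intro sum_mono) (simp add: N mult_right_mono Finite_Cartesian_Product.norm_nth_le)
    also have "\<dots> \<le> C * norm x"
      by (simp add: C_def algebra_simps flip: sum_distrib_left)
    finally show ?thesis .
  qed
  moreover have "C > 0"
    unfolding C_def by (intro add_pos_nonneg sum_nonneg N) auto
  ultimately show ?thesis using that by blast
qed

lemma complex_norm_continuous: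
  assumes "is_complex_norm N"
  shows "continuous_on UNIV N"
proof -
  obtain C where C: "C > 0" "\<And>x. N x \<le> C * norm x"
    using complex_norm_le_norm[OF assms] by blast
  have tri: "N (x + y) \<le> N x + N y" for x y
    using assms unfolding is_complex_norm_def by blast
  have "dist (N x) (N y) \<le> C * dist x y" for x y
    using tri[of "x - y" y] tri[of "y - x" x] complex_norm_neg[OF assms, of "x - y"] C(2)[of "x - y"]
    by (simp add: dist_norm abs_real_def)
  then have "C-lipschitz_on UNIV N"
    using C by (intro lipschitz_onI) auto
  then show ?thesis
    by (rule lipschitz_on_continuous_on)
qed

text \<open>Compactness: \<open>N\<close> attains a positive minimum on the Euclidean unit sphere,
  and homogeneity carries the bound to all vectors.\<close>

lemma norm_le_complex_norm:
  assumes "is_complex_norm N"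
  obtains c where "c > 0" "\<And>x. norm x \<le> c * N x"
proof -
  have N: "\<And>x. 0 \<le> N x" "\<And>x. N x = 0 \<longleftrightarrow> x = 0" "\<And>c x. N (c *s x) = cmod c * N x"
    using assms unfolding is_complex_norm_def by auto
  have "continuous_on (sphere 0 1) N"
    using complex_norm_continuous[OF assms] continuous_on_subset by blast
  moreover have "axis undefined 1 \<in> sphere (0 :: complex ^ 'a) 1"
    by simp
  ultimately obtain u where u: "u \<in> sphere 0 1" "\<And>v. v \<in> sphere 0 1 \<Longrightarrow> N u \<le> N v"
    using continuous_attains_inf[of "sphere 0 1" N] by (metis compact_sphere empty_iff)
  have pos: "N u > 0"
    using u(1) N(1,2)[of u] by (auto simp: less_le)
  have "norm x \<le> 1 / N u * N x" for x
  proof (cases "x = 0")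
    case False
    have "complex_of_real (inverse (norm x)) *s x = inverse (norm x) *\<^sub>R x"
      by (simp add: vec_eq_iff scaleR_conv_of_real[where 'a = complex])
    moreover have "norm (inverse (norm x) *\<^sub>R x) = 1"
      using False by simp
    ultimately have "N u \<le> N (complex_of_real (inverse (norm x)) *s x)"
      using u(2) by simp
    also have "\<dots> = inverse (norm x) * N x"
      unfolding N(3) norm_of_real by simp
    finally show ?thesis
      using False pos by (simp add: field_simps)
  qed (simp add: N)
  then show ?thesis
    using that pos by (metis divide_pos_pos zero_less_one)
qed

subsection \<open>The Riesz projection of a contraction\<close>

lemma matrix_inv_invertible:
  fixes A :: "complex ^ 'n ^ 'n"
  assumes "invertible A"
  shows "A ** matrix_inv A = mat 1" "matrix_inv A ** A = mat 1"
  using assms someI_ex[of "\<lambda>A'. A ** A' = mat 1 \<and> A' ** A = mat 1"]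
  unfolding invertible_def matrix_inv_def by auto

lemma mat_mult_vec: "mat z *v x = z *s (x :: complex ^ 'n)"
  by (simp add: vec_eq_iff matrix_vector_mult_def mat_def if_distrib[where f = "\<lambda>x. x * _"] cong: if_cong)

text \<open>Cramer's rule, applied to the columns of the inverse. It turns resolvent entries into
  quotients of functions that are polynomial in \<open>z\<close>.\<close>

lemma matrix_inv_entry_cramer:
  fixes A :: "complex ^ 'n ^ 'n"
  assumes "det A \<noteq> 0"
  shows "matrix_inv A $ i $ j = det (\<chi> k l. if l = i then axis j 1 $ k else A $ k $ l) / det A"
proof -
  have "A *v (matrix_inv A *v axis j 1) = axis j 1"
    using assms by (simp add: matrix_vector_mul_assoc matrix_inv_invertible invertible_det_nz)
  then have "matrix_inv A *v axis j 1 =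
      (\<chi> i. det (\<chi> k l. if l = i then axis j 1 $ k else A $ k $ l) / det A)"
    by (simp add: cramer[OF assms])
  then show ?thesis
    by (simp add: vec_eq_iff matrix_vector_mult_def axis_def
        if_distrib[where f = "\<lambda>x. _ * x"] cong: if_cong)
qed

lemma det_holomorphic:
  fixes F :: "complex \<Rightarrow> complex ^ 'n ^ 'n"
  assumes "\<And>i j. (\<lambda>z. F z $ i $ j) holomorphic_on X"
  shows "(\<lambda>z. det (F z)) holomorphic_on X"
  unfolding det_def by (intro holomorphic_intros assms)

lemma mat_minus_entry_holomorphic:
  "(\<lambda>z. (mat z - A) $ i $ j) holomorphic_on X"
  by (cases "i = j") (auto simp: mat_def intro!: holomorphic_intros)

text \<open>One point \<open>z0\<close> with nonzero determinant ensures that the denominator in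
  Cramer's rule does not vanish identically.\<close>

lemma resolvent_meromorphic:
  fixes A :: "complex ^ 'n ^ 'n"
  assumes "det (mat z0 - A) \<noteq> 0"
  shows "(\<lambda>z. matrix_inv (mat z - A) $ i $ j) meromorphic_on {w}"
proof -
  define g where "g = (\<lambda>z. det (\<chi> k l. if l = i then axis j 1 $ k else (mat z - A) $ k $ l))"
  define d where "d = (\<lambda>z. det (mat z - A))"
  have d: "d holomorphic_on UNIV"
    unfolding d_def by (intro det_holomorphic mat_minus_entry_holomorphic)
  have "(\<lambda>z. if l = i then axis j 1 $ k else (mat z - A) $ k $ l) holomorphic_on UNIV" for k l
    by (cases "l = i") (simp_all add: mat_minus_entry_holomorphic del: vector_minus_component)
  then have g: "g holomorphic_on UNIV"
    unfolding g_def by (intro det_holomorphic) (simp del: vector_minus_component)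
  have "(\<lambda>z. g z / d z) meromorphic_on {w}"
    using d g by (intro meromorphic_intros analytic_on_imp_meromorphic_on)
      (auto intro: holomorphic_on_imp_analytic_at[where A = UNIV])
  \<comment> \<open>Zeros of a nonzero entire function are isolated, so Cramer's rule holds on a
    punctured neighbourhood of \<open>w\<close>, even if \<open>w\<close> is an eigenvalue.\<close>
  moreover have "eventually (\<lambda>z. d z \<noteq> 0) (at w)"
    using non_zero_neighbour_alt[OF d open_UNIV connected_UNIV UNIV_I UNIV_I] assms
    by (auto simp: d_def elim: eventually_mono)
  then have "eventually (\<lambda>z. matrix_inv (mat z - A) $ i $ j = g z / d z) (at w)"
    by eventually_elim (simp add: d_def g_def matrix_inv_entry_cramer)
  ultimately show ?thesis
    by (subst meromorphic_on_cong) auto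
qed

text \<open>The function \<open>f u * (u - w)\<close> is meromorphic, so at \<open>w\<close> it has
  a finite limit or a pole. Boundedness along one sequence excludes the pole, and the limit is then
  the residue.\<close>

lemma residue_eq_limit_of_bounded_sequence:
  assumes f: "f meromorphic_on {w}"
    and z: "filterlim z (at w) sequentially"
    and bounded: "\<And>n. cmod ((z n - w) * f (z n)) \<le> B"
  shows "(\<lambda>n. (z n - w) * f (z n)) \<longlonglongrightarrow> residue f w"
proof -
  define h where "h = (\<lambda>u. f u * (u - w))"
  have "h meromorphic_on {w}"
    unfolding h_def using f by (intro meromorphic_intros)
  then have "not_essential h w"
    by (rule meromorphic_on_not_essential)
  moreover have "\<not> is_pole h w"
  proof
    assume "is_pole h w"
    then have "filterlim (\<lambda>n. h (z n)) at_infinity sequentially"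
      unfolding is_pole_def using z by (rule filterlim_compose)
    then have "eventually (\<lambda>n. cmod (h (z n)) \<ge> max 0 B + 1) sequentially"
      unfolding filterlim_at_infinity[OF order_refl] by (metis less_add_same_cancel2 max.cobounded1 add_nonneg_pos zero_less_one)
    then obtain n where "cmod (h (z n)) \<ge> max 0 B + 1"
      using eventually_happens' sequentially_bot by blast
    then show False
      using bounded[of n] by (simp add: h_def mult.commute)
  qed
  ultimately obtain c where c: "h \<midarrow>w\<rightarrow> c"
    unfolding not_essential_def by blast
  obtain r where "r > 0" "f analytic_on ball w r - {w}"
    using meromorphic_on_isolated_singularity[OF f] unfolding isolated_singularity_at_def by blast
  then have "residue f w = c"
    using c unfolding h_def
    by (intro residue_simple'[of "ball w r"]) (auto intro: analytic_imp_holomorphic)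
  then show ?thesis
    using filterlim_compose[OF c z] by (simp add: h_def mult.commute)
qed

section \<open>The resolvent of a contraction along \<open>1 + approach n\<close>, decreasing to
  1\<close>

definition approach :: "nat \<Rightarrow> real" where
  "approach n = inverse (real (Suc n))"

lemma approach_pos: "approach n > 0"
  by (simp add: approach_def)

lemma approach_tendsto: "(\<lambda>n. complex_of_real (approach n)) \<longlonglongrightarrow> 0"
  using tendsto_of_real[OF LIMSEQ_inverse_real_of_nat] by (simp add: approach_def del: of_real_inverse of_nat_Suc)

context
  fixes A :: "complex ^ 'd ^ 'd" and N :: "complex ^ 'd \<Rightarrow> real"
  assumes N: "is_complex_norm N" and contraction: "\<And>x. N (A *v x) \<le> N x"
begin

text \<open>Triangle inequality for \<open>z x = (z - A) x + A x\<close>. It yields injectivity of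
  \<open>z - A\<close> outside the closed unit disc as well as the resolvent bound.\<close>

lemma contraction_resolvent_lower_bound: "(cmod z - 1) * N x \<le> N ((mat z - A) *v x)"
proof -
  have "z *s x = (mat z - A) *v x + A *v x"
    by (simp add: mat_mult_vec matrix_vector_mult_diff_rdistrib)
  then have "cmod z * N x \<le> N ((mat z - A) *v x) + N (A *v x)"
    using N unfolding is_complex_norm_def by metis
  then show ?thesis
    using contraction[of x] by (simp add: algebra_simps)
qed

lemma contraction_resolvent_invertible:
  assumes "cmod z > 1"
  shows "invertible (mat z - A)"
proof -
  have "x = 0" if "(mat z - A) *v x = 0" for x
  proof -
    have "N 0 = 0"
      using N unfolding is_complex_norm_def by blast
    then have "(cmod z - 1) * N x \<le> 0"
      using contraction_resolvent_lower_bound[of z x] that by simp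
    then have "N x \<le> 0"
      using assms by (simp add: mult_le_0_iff)
    then show ?thesis
      using N unfolding is_complex_norm_def by (meson order_antisym)
  qed
  then show ?thesis
    by (simp add: invertible_left_inverse matrix_left_invertible_ker)
qed

lemma contraction_resolvent_bound:
  assumes "t > 0"
  shows "N (of_real t *s (matrix_inv (mat (1 + of_real t) - A) *v x)) \<le> N x"
proof -
  have w: "cmod (1 + of_real t) = 1 + t"
    using assms norm_of_real[of "1 + t", where 'a = complex] by simp
  let ?R = "matrix_inv (mat (1 + of_real t) - A)"
  have "(mat (1 + of_real t) - A) *v (?R *v x) = x"
    using w assms
    by (simp add: matrix_vector_mul_assoc matrix_inv_invertible contraction_resolvent_invertible)
  then have "t * N (?R *v x) \<le> N x"
    using contraction_resolvent_lower_bound[of "1 + of_real t" "?R *v x"] w by simp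
  then show ?thesis
    using N assms unfolding is_complex_norm_def by simp
qed

text \<open>
  The resolvent bound along \<open>z \<down> 1\<close> excludes poles of order at least two, so that \<open>1\<close> is at most
  a simple pole and the Riesz projection is an Abel limit.
\<close>

lemma riesz_projection_limit:
  "(\<lambda>n. of_real (approach n) *s (matrix_inv (mat (1 + of_real (approach n)) - A) *v x))
    \<longlonglongrightarrow> riesz_projection A 1 *v x"
proof -
  let ?t = "\<lambda>n. complex_of_real (approach n)"
  let ?f = "\<lambda>i j z. matrix_inv (mat z - A) $ i $ j"
  obtain c where c: "c > 0" "\<And>x. norm x \<le> c * N x"
    using norm_le_complex_norm[OF N] by blast
  have t: "?t \<longlonglongrightarrow> 0"
    by (rule approach_tendsto)
  have "(\<lambda>n. 1 + ?t n) \<longlonglongrightarrow> 1"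
    using tendsto_add[OF tendsto_const t, of 1] by simp
  then have lim: "filterlim (\<lambda>n. 1 + ?t n) (at 1) sequentially"
    using approach_pos by (auto simp: filterlim_at less_imp_neq[symmetric])
  have "cmod ((1 + ?t n - 1) * ?f i j (1 + ?t n)) \<le> c * N (axis j 1)" for i j n
  proof -
    have "(1 + ?t n - 1) * ?f i j (1 + ?t n) =
        (?t n *s (matrix_inv (mat (1 + ?t n) - A) *v axis j 1)) $ i"
      by (simp add: matrix_vector_mult_def axis_def
        if_distrib[where f = "\<lambda>x. _ * x"] cong: if_cong)
    also have "cmod \<dots> \<le> norm (?t n *s (matrix_inv (mat (1 + ?t n) - A) *v axis j 1))"
      by (rule Finite_Cartesian_Product.norm_nth_le)
    also have "\<dots> \<le> c * N (axis j 1)"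
      using c contraction_resolvent_bound[OF approach_pos, of n "axis j 1"]
      by (meson mult_left_mono order_trans less_imp_le)
    finally show ?thesis .
  qed
  moreover have "?f i j meromorphic_on {1}" for i j
    \<comment> \<open>The point 2 lies outside the closed unit disc and serves as the required
      non-eigenvalue.\<close>
    using contraction_resolvent_invertible[of 2] by (intro resolvent_meromorphic) (simp add: invertible_det_nz)
  ultimately have "(\<lambda>n. (1 + ?t n - 1) * ?f i j (1 + ?t n)) \<longlonglongrightarrow> residue (?f i j) 1" for i j
    using lim by (intro residue_eq_limit_of_bounded_sequence)
  then have "(\<lambda>n. (\<chi> i j. ?t n * ?f i j (1 + ?t n)) *v x) \<longlonglongrightarrow> riesz_projection A 1 *v x"
    by (intro tendsto_matrix_mult_vec) (simp add: riesz_projection_def)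
  moreover have "(\<chi> i j. ?t n * ?f i j (1 + ?t n)) *v x = ?t n *s (matrix_inv (mat (1 + ?t n) - A) *v x)" for n
    by (simp add: vec_eq_iff matrix_vector_mult_def sum_distrib_left mult_ac)
  ultimately show ?thesis by simp
qed

lemma approach_resolvent:
  "matrix_inv (mat (1 + of_real (approach n)) - A) *v ((mat (1 + of_real (approach n)) - A) *v x) = x"
proof -
  have "cmod (1 + of_real (approach n)) > 1"
    using norm_of_real[of "1 + approach n", where 'a = complex] by (simp add: approach_def)
  then show ?thesis
    by (simp add: matrix_vector_mul_assoc matrix_inv_invertible contraction_resolvent_invertible)
qed

lemma riesz_projection_contraction: "N (riesz_projection A 1 *v x) \<le> N x"
proof (rule LIMSEQ_le_const2)
  show "(\<lambda>n. N (of_real (approach n) *s (matrix_inv (mat (1 + of_real (approach n)) - A) *v x)))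
    \<longlonglongrightarrow> N (riesz_projection A 1 *v x)"
    using complex_norm_continuous[OF N] riesz_projection_limit
    by (rule continuous_on_tendsto_compose) auto
qed (use contraction_resolvent_bound[OF approach_pos] in blast)

text \<open>For a fixed vector, \<open>(1 + t - A) x = t x\<close>, so the approximating sequence is
  constantly \<open>x\<close>.\<close>

lemma riesz_projection_fixed:
  assumes "A *v x = x"
  shows "riesz_projection A 1 *v x = x"
proof -
  have "of_real (approach n) *s x = (mat (1 + of_real (approach n)) - A) *v x" for n
    by (simp add: mat_mult_vec matrix_vector_mult_diff_rdistrib assms vector_sadd_rdistrib)
  then have "of_real (approach n) *s (matrix_inv (mat (1 + of_real (approach n)) - A) *v x) = x" for n
    by (metis approach_resolvent vector_scalar_commute)
  then show ?thesis
    using riesz_projection_limit[of x] LIMSEQ_unique by (simp add: LIMSEQ_const_iff)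
qed

text \<open>With \<open>R\<close> the resolvent at \<open>1 + t\<close>, writing
  \<open>A = (1 + t) - (1 + t - A)\<close> gives \<open>t R A = (1 + t) t R - t\<close>; let
  \<open>t\<close> tend to 0.\<close>

lemma riesz_projection_mult: "riesz_projection A 1 *v (A *v x) = riesz_projection A 1 *v x"
proof -
  let ?t = "\<lambda>n. complex_of_real (approach n)"
  let ?R = "\<lambda>n. matrix_inv (mat (1 + ?t n) - A)"
  have t: "?t \<longlonglongrightarrow> 0"
    by (rule approach_tendsto)
  have "?t n *s (?R n *v (A *v x)) = (1 + ?t n) *s (?t n *s (?R n *v x)) - ?t n *s x" for n
  proof -
    have "A *v x = (1 + ?t n) *s x - (mat (1 + ?t n) - A) *v x"
      by (simp add: mat_mult_vec matrix_vector_mult_diff_rdistrib)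
    then have R: "?R n *v (A *v x) = (1 + ?t n) *s (?R n *v x) - x"
      by (simp add: matrix_vector_mult_diff_distrib matrix_vector_right_distrib approach_resolvent vector_scalar_commute)
    show ?thesis
      unfolding R by (simp add: vec_eq_iff algebra_simps)
  qed
  moreover have "(\<lambda>n. (1 + ?t n) *s (?t n *s (?R n *v x)) - ?t n *s x)
      \<longlonglongrightarrow> (1 + 0) *s (riesz_projection A 1 *v x) - 0 *s x"
    by (intro tendsto_intros tendsto_vec_scale riesz_projection_limit t)
  ultimately show ?thesis
    using riesz_projection_limit[of "A *v x"] LIMSEQ_unique by fastforce
qed

end

subsection \<open>Inner products, adjoints and ordered products\<close>

lemma cinner_self: "cinner x x = of_real ((norm x)\<^sup>2)"
proof -
  have "(norm x)\<^sup>2 = (\<Sum>i\<in>UNIV. (cmod (x $ i))\<^sup>2)"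
    by (simp add: norm_vec_def L2_set_def sum_nonneg)
  moreover have "cnj (x $ i) * x $ i = of_real ((cmod (x $ i))\<^sup>2)" for i
    using complex_norm_square[of "x $ i"] by (simp add: mult.commute)
  ultimately show ?thesis
    by (simp add: cinner_def)
qed

lemma cinner_Cauchy_Schwarz: "cmod (cinner x y) \<le> norm x * norm y"
proof -
  have "cmod (cinner x y) \<le> (\<Sum>i\<in>UNIV. \<bar>cmod (x $ i)\<bar> * \<bar>cmod (y $ i)\<bar>)"
    unfolding cinner_def by (rule sum_norm_le) (simp add: norm_mult)
  also have "\<dots> \<le> norm x * norm y"
    unfolding norm_vec_def by (rule L2_set_mult_ineq)
  finally show ?thesis .
qed

lemma cinner_commute: "cinner x y = cnj (cinner y x)"
  by (simp add: cinner_def mult.commute)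

lemma cinner_diff_right: "cinner x (y - z) = cinner x y - cinner x z"
  by (simp add: cinner_def algebra_simps sum_subtractf)

lemma cinner_diff_left: "cinner (x - y) z = cinner x z - cinner y z"
  by (simp add: cinner_def algebra_simps sum_subtractf)

lemma cinner_scale_right: "cinner x (c *s y) = c * cinner x y"
  by (simp add: cinner_def sum_distrib_left mult_ac)

lemma cinner_scale_left: "cinner (c *s x) y = cnj c * cinner x y"
  by (simp add: cinner_def sum_distrib_left mult_ac)

lemma cinner_ext:
  assumes "\<And>z. cinner x z = cinner y z"
  shows "x = y"
proof -
  have "cinner (x - y) (x - y) = 0"
    by (simp add: cinner_diff_left assms)
  then show ?thesis
    by (simp add: cinner_self)
qed

lemma tendsto_cinner_right:
  assumes "y \<longlonglongrightarrow> z"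
  shows "(\<lambda>n. cinner x (y n)) \<longlonglongrightarrow> cinner x z"
  unfolding cinner_def by (intro tendsto_intros tendsto_vec_nth assms)

text \<open>Pair the vector \<open>cadjoint A *v y\<close> with itself, move \<open>A\<close> to the
  other side and apply Cauchy-Schwarz.\<close>

lemma norm_cadjoint_mult_vec_le:
  assumes "\<And>x. norm (A *v x) \<le> K * norm x"
  shows "norm (cadjoint A *v y) \<le> K * norm y"
proof (cases "cadjoint A *v y = 0")
  case True
  have "0 \<le> K * norm y"
    using assms[of y] norm_ge_zero order_trans by blast
  then show ?thesis
    using True by simp
next
  case False
  let ?z = "cadjoint A *v y"
  have "(norm ?z)\<^sup>2 = cmod (cinner ?z ?z)"
    by (simp only: cinner_self norm_of_real) simp
  also have "\<dots> = cmod (cinner y (A *v ?z))"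
    by (simp add: cinner_cadjoint)
  also have "\<dots> \<le> norm y * norm (A *v ?z)"
    by (rule cinner_Cauchy_Schwarz)
  also have "\<dots> \<le> norm y * (K * norm ?z)"
    by (intro mult_left_mono assms) simp
  finally have "norm ?z * norm ?z \<le> (K * norm y) * norm ?z"
    by (simp add: power2_eq_square mult_ac)
  then show ?thesis
    using False by simp
qed

lemma cadjoint_mult: "cadjoint (A ** B) = cadjoint B ** cadjoint A"
  by (simp add: vec_eq_iff cadjoint_def matrix_matrix_mult_def mult.commute)

lemma cadjoint_mat_1: "cadjoint (mat 1) = mat 1"
  by (simp add: vec_eq_iff cadjoint_def mat_def)

lemma mat_prod_list_Nil: "mat_prod_list [] = mat 1"
  by (simp add: mat_prod_list_def)

lemma mat_prod_list_Cons: "mat_prod_list (A # As) = A ** mat_prod_list As"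
  by (simp add: mat_prod_list_def)

lemma mat_prod_list_snoc: "mat_prod_list (As @ [A]) = mat_prod_list As ** A"
  by (induction As) (simp_all add: mat_prod_list_Nil mat_prod_list_Cons matrix_mul_assoc)

lemma norm_mult_vec_le_onorm: "norm (A *v x) \<le> onorm ((*v) A) * norm x"
  for A :: "complex ^ 'n ^ 'm"
  by (intro onorm matrix_vector_mul_bounded_linear)

lemma cmod_entry_le_onorm: "cmod (A $ i $ j) \<le> onorm ((*v) A)"
  for A :: "complex ^ 'n ^ 'm"
proof -
  have "A $ i $ j = (A *v axis j 1) $ i"
    by (simp add: matrix_vector_mult_def axis_def if_distrib[where f = "\<lambda>x. _ * x"] cong: if_cong)
  then have "cmod (A $ i $ j) \<le> norm (A *v axis j 1)"
    using Finite_Cartesian_Product.norm_nth_le by metis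
  then show ?thesis
    using norm_mult_vec_le_onorm[of A "axis j 1"] by simp
qed

lemma ketbra_entry: "ketbra \<psi> \<phi> $ i $ j = \<psi> $ i * cnj (\<phi> $ j)"
proof -
  have "ketbra \<psi> \<phi> $ i $ j = (ketbra \<psi> \<phi> *v axis j 1) $ i"
    by (simp add: matrix_vector_mult_def axis_def if_distrib[where f = "\<lambda>x. _ * x"] cong: if_cong)
  also have "\<dots> = \<psi> $ i * cnj (\<phi> $ j)"
    unfolding ketbra_mult_vec
    by (simp add: cinner_def axis_def if_distrib[where f = "\<lambda>x. _ * x"] cong: if_cong)
  finally show ?thesis .
qed

lemma tendsto_ketbra:
  assumes "\<phi> \<longlonglongrightarrow> \<phi>'"
  shows "(\<lambda>n. ketbra \<psi> (\<phi> n)) \<longlonglongrightarrow> ketbra \<psi> \<phi>'"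
  by (intro vec_tendstoI) (auto simp: ketbra_entry intro!: tendsto_intros tendsto_vec_nth assms)

text \<open>The step length \<open>m\<close> is the same for all \<open>\<eta>\<close>; only the
  starting index may depend on it. Iterating the halving makes the initial bound negligible and
  leaves a multiple of \<open>\<eta>\<close>.\<close>

lemma eventually_halving_tendsto_0:
  fixes a :: "nat \<Rightarrow> real"
  assumes nonneg: "\<And>n. 0 \<le> a n" and bounded: "\<And>n. n \<ge> 1 \<Longrightarrow> a n \<le> B"
    and step: "\<And>\<eta>. \<eta> > 0 \<Longrightarrow> \<exists>n0. \<forall>n\<ge>n0. a (n + m) \<le> 1/2 * a n + \<eta>"
  shows "a \<longlonglongrightarrow> 0"
proof (rule LIMSEQ_I)
  fix r :: real
  assume "r > 0"
  \<comment> \<open>The final bound is \<open>\<eta> + 2 * \<eta>\<close>, which is three quarters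
    of \<open>r\<close>.\<close>
  define \<eta> where "\<eta> = r / 4"
  have \<eta>: "\<eta> > 0"
    using \<open>r > 0\<close> by (simp add: \<eta>_def)
  obtain n0 where n0: "\<And>n. n \<ge> n0 \<Longrightarrow> a (n + m) \<le> 1/2 * a n + \<eta>"
    using step[OF \<eta>] by blast
  \<comment> \<open>The constant \<open>2 * \<eta>\<close> is the fixed point of
    \<open>x \<mapsto> x / 2 + \<eta>\<close>, so it survives the induction.\<close>
  have iterate: "a (n + k * m) \<le> B / 2 ^ k + 2 * \<eta>" if "n \<ge> max n0 1" for n k
  proof (induction k)
    case 0
    then show ?case
      using bounded[of n] that \<eta> by simp
  next
    case (Suc k)
    have "a (n + Suc k * m) \<le> 1/2 * a (n + k * m) + \<eta>"
      using n0[of "n + k * m"] that by (simp add: algebra_simps)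
    also have "\<dots> \<le> 1/2 * (B / 2 ^ k + 2 * \<eta>) + \<eta>"
      using Suc by simp
    also have "\<dots> = B / 2 ^ Suc k + 2 * \<eta>"
      by simp
    finally show ?case .
  qed
  have "(\<lambda>k. B * (1/2) ^ k) \<longlonglongrightarrow> B * 0"
    by (intro tendsto_intros LIMSEQ_realpow_zero) auto
  then have "eventually (\<lambda>k. B * (1/2) ^ k < \<eta>) sequentially"
    using order_tendstoD(2)[of _ "B * 0"] \<eta> by simp
  then obtain k where "B * (1/2) ^ k < \<eta>"
    using eventually_happens' sequentially_bot by blast
  then have k: "B / 2 ^ k < \<eta>"
    by (simp add: power_one_over)
  have "norm (a n - 0) < r" if "n \<ge> max n0 1 + k * m" for n
  proof -
    have "max n0 1 \<le> n - k * m"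
      by (intro add_le_imp_le_diff that)
    then have "a (n - k * m + k * m) \<le> B / 2 ^ k + 2 * \<eta>"
      by (rule iterate)
    moreover have eq: "n - k * m + k * m = n"
      using that by (intro le_add_diff_inverse2) (rule add_leD2)
    ultimately have "a n < r"
      using k \<open>r > 0\<close> unfolding \<eta>_def eq by linarith
    then show ?thesis
      using nonneg[of n] by simp
  qed
  then show "\<exists>no. \<forall>n\<ge>no. norm (a n - 0) < r"
    by blast
qed

subsection \<open>Families of contractions with a common fixed vector\<close>

locale contractive_family =
  fixes M :: "nat \<Rightarrow> complex ^ 'd ^ 'd" and S :: "complex ^ 'd" and N :: "complex ^ 'd \<Rightarrow> real"
  assumes complex_norm: "is_complex_norm N"
    and contraction: "\<And>j x. j \<ge> 1 \<Longrightarrow> N (M j *v x) \<le> N x"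
    and norm_S: "norm S = 1"
    and fixes_S: "\<And>j. j \<ge> 1 \<Longrightarrow> M j *v S = S"
begin

text \<open>A Euclidean operator norm bound shared by all \<open>N\<close>-contractions; the product
  of the two norm equivalence constants is a witness.\<close>

definition K :: real where
  "K = (SOME K. K > 0 \<and> (\<forall>A x. (\<forall>y. N (A *v y) \<le> N y) \<longrightarrow> norm (A *v x) \<le> K * norm x))"

lemma K: "K > 0" "(\<And>y. N (A *v y) \<le> N y) \<Longrightarrow> norm (A *v x) \<le> K * norm x"
proof -
  obtain C where C: "C > 0" "\<And>x. N x \<le> C * norm x"
    using complex_norm_le_norm[OF complex_norm] by blast
  obtain c where c: "c > 0" "\<And>x. norm x \<le> c * N x"
    using norm_le_complex_norm[OF complex_norm] by blast
  have "norm (A *v x) \<le> c * C * norm x" if "\<forall>y. N (A *v y) \<le> N y" for A x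
  proof -
    have "norm (A *v x) \<le> c * N (A *v x)"
      by (rule c)
    also have "\<dots> \<le> c * (C * norm x)"
      using c(1) that C(2)[of x] by (intro mult_left_mono) (auto intro: order_trans)
    finally show ?thesis
      by simp
  qed
  then have "\<exists>K. K > 0 \<and> (\<forall>A x. (\<forall>y. N (A *v y) \<le> N y) \<longrightarrow> norm (A *v x) \<le> K * norm x)"
    using C(1) c(1) by (intro exI[of _ "c * C"]) auto
  then have "K > 0 \<and> (\<forall>A x. (\<forall>y. N (A *v y) \<le> N y) \<longrightarrow> norm (A *v x) \<le> K * norm x)"
    unfolding K_def by (rule someI_ex)
  then show "K > 0" "(\<And>y. N (A *v y) \<le> N y) \<Longrightarrow> norm (A *v x) \<le> K * norm x"
    by auto
qed

abbreviation \<psi> :: "nat \<Rightarrow> complex ^ 'd" where "\<psi> \<equiv> psi_vec M S"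
abbreviation \<theta> :: "nat \<Rightarrow> complex ^ 'd" where "\<theta> \<equiv> theta_vec M S"
abbreviation MQ :: "nat \<Rightarrow> complex ^ 'd ^ 'd" where "MQ \<equiv> MQ_mat M S"

lemma norm_M_adjoint_le:
  assumes "j \<ge> 1"
  shows "norm (cadjoint (M j) *v x) \<le> K * norm x"
  by (intro norm_cadjoint_mult_vec_le K contraction assms)

text \<open>The bound is uniform in \<open>j\<close> because every Riesz projection is itself an
  \<open>N\<close>-contraction.\<close>

lemma norm_psi_le:
  assumes "j \<ge> 1"
  shows "norm (\<psi> j) \<le> K"
proof -
  have "norm (\<psi> j) \<le> K * norm S"
    unfolding psi_vec_def
    by (intro norm_cadjoint_mult_vec_le K riesz_projection_contraction complex_norm contraction assms)
  then show ?thesis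
    by (simp add: norm_S)
qed

lemma cinner_psi_S:
  assumes "j \<ge> 1"
  shows "cinner (\<psi> j) S = 1"
proof -
  have "riesz_projection (M j) 1 *v S = S"
    using assms by (intro riesz_projection_fixed[OF complex_norm] contraction fixes_S)
  then show ?thesis
    by (simp add: psi_vec_def cinner_cadjoint cinner_self norm_S)
qed

lemma cinner_S_psi:
  assumes "j \<ge> 1"
  shows "cinner S (\<psi> j) = 1"
  using cinner_psi_S[OF assms] cinner_commute[of S "\<psi> j"] by simp

lemma M_adjoint_psi:
  assumes "j \<ge> 1"
  shows "cadjoint (M j) *v \<psi> j = \<psi> j"
proof (rule cinner_ext)
  fix x
  show "cinner (cadjoint (M j) *v \<psi> j) x = cinner (\<psi> j) x"
    unfolding psi_vec_def cinner_cadjoint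
    using riesz_projection_mult[OF complex_norm contraction[OF assms]] by simp
qed

lemma cinner_S_M_adjoint:
  assumes "j \<ge> 1"
  shows "cinner S (cadjoint (M j) *v x) = cinner S x"
  using fixes_S[OF assms] cinner_cadjoint[of "M j" x S] by (metis cinner_commute)

section \<open>The compressions \<open>MQ\<close> and perturbed recursions for their
  adjoints\<close>

lemma MQ_mult_vec:
  assumes "j \<ge> 1"
  shows "MQ j *v x = M j *v x - cinner (\<psi> j) x *s S"
proof -
  have Q: "Q_mat M S j *v y = y - cinner (\<psi> j) y *s S" for y
    by (simp add: Q_mat_def P_mat_def matrix_vector_mult_diff_rdistrib ketbra_mult_vec)
  have "cinner (\<psi> j) (M j *v y) = cinner (\<psi> j) y" for y
    using M_adjoint_psi[OF assms] by (metis cinner_cadjoint)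
  then have "Q_mat M S j *v (M j *v (Q_mat M S j *v x)) = M j *v x - cinner (\<psi> j) x *s S"
    by (simp add: Q matrix_vector_mult_diff_distrib vector_scalar_commute fixes_S[OF assms]
        cinner_diff_right cinner_scale_right cinner_psi_S[OF assms])
  then show ?thesis
    by (simp add: MQ_mat_def matrix_vector_mul_assoc matrix_mul_assoc)
qed

lemma MQ_S:
  assumes "j \<ge> 1"
  shows "MQ j *v S = 0"
  by (simp add: MQ_mult_vec[OF assms] fixes_S[OF assms] cinner_psi_S[OF assms])

text \<open>On vectors orthogonal to \<open>S\<close> the adjoints of \<open>MQ j\<close> and
  \<open>M j\<close> agree, so recursions driven by \<open>M\<close> can be read as recursions
  driven by \<open>MQ\<close>.\<close>

lemma MQ_adjoint_mult_vec:
  assumes "j \<ge> 1"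
  shows "cadjoint (MQ j) *v u = cadjoint (M j) *v u - cinner S u *s \<psi> j"
proof (rule cinner_ext)
  fix x
  show "cinner (cadjoint (MQ j) *v u) x = cinner (cadjoint (M j) *v u - cinner S u *s \<psi> j) x"
    using cinner_commute[of u S]
    by (simp add: cinner_cadjoint MQ_mult_vec[OF assms] cinner_diff_left cinner_diff_right
        cinner_scale_left cinner_scale_right)
qed

lemma norm_MQ_adjoint_le:
  assumes "j \<ge> 1"
  shows "norm (cadjoint (MQ j) *v x) \<le> (2 * K + 1) * norm x"
proof -
  have "norm (cinner S x *s \<psi> j) = cmod (cinner S x) * norm (\<psi> j)"
    by (simp add: norm_vec_def L2_set_right_distrib norm_mult)
  also have "\<dots> \<le> (norm S * norm x) * K"
    using K(1) by (intro mult_mono cinner_Cauchy_Schwarz norm_psi_le assms) auto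
  finally have "norm (cinner S x *s \<psi> j) \<le> K * norm x"
    by (simp add: norm_S mult_ac)
  then have "norm (cadjoint (MQ j) *v x) \<le> K * norm x + K * norm x"
    unfolding MQ_adjoint_mult_vec[OF assms]
    using norm_M_adjoint_le[OF assms, of x] norm_triangle_ineq4 by (meson add_mono order_trans)
  \<comment> \<open>The estimate gives the factor \<open>2 * K\<close>; the extra 1 makes the
    constant at least 1, so that its powers dominate 1 later.\<close>
  moreover have "(2 * K + 1) * norm x = K * norm x + K * norm x + norm x"
    by (simp add: algebra_simps)
  ultimately show ?thesis
    using norm_ge_zero[of x] by linarith
qed

text \<open>Discrete variation of constants: each of \<open>m\<close> errors passes through fewer
  than \<open>m\<close> factors, each of norm at most \<open>2 * K + 1\<close>.\<close>

lemma perturbed_product: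
  assumes "\<And>k. j k \<ge> 1" and "0 \<le> \<eta>"
    and "\<And>k. u (Suc k) = cadjoint (MQ (j k)) *v u k + e k" and "\<And>k. norm (e k) \<le> \<eta>"
  shows "norm (u m - cadjoint (mat_prod_list (map MQ (map j [0..<m]))) *v u 0)
    \<le> real m * (2 * K + 1) ^ m * \<eta>"
proof (induction m)
  case 0
  then show ?case
    by (simp add: mat_prod_list_Nil cadjoint_mat_1)
next
  case (Suc m)
  let ?C = "2 * K + 1" and ?P = "\<lambda>m. cadjoint (mat_prod_list (map MQ (map j [0..<m])))"
  have C: "?C \<ge> 1"
    using K(1) by simp
  \<comment> \<open>Taking adjoints reverses the product, so the newest index acts last, as the
    recursion requires.\<close>
  have P: "?P (Suc m) = cadjoint (MQ (j m)) ** ?P m"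
    by (simp add: mat_prod_list_snoc cadjoint_mult)
  have "u (Suc m) - ?P (Suc m) *v u 0 = cadjoint (MQ (j m)) *v (u m - ?P m *v u 0) + e m"
    unfolding P by (simp add: assms matrix_vector_mult_diff_distrib matrix_vector_mul_assoc del: upt_Suc)
  then have "norm (u (Suc m) - ?P (Suc m) *v u 0)
      \<le> norm (cadjoint (MQ (j m)) *v (u m - ?P m *v u 0)) + norm (e m)"
    by (metis norm_triangle_ineq)
  also have "\<dots> \<le> ?C * (real m * ?C ^ m * \<eta>) + \<eta>"
    using norm_MQ_adjoint_le[OF assms(1), of m "u m - ?P m *v u 0"] Suc assms(4)[of m] C
    by (meson add_mono order_trans mult_left_mono zero_le_one)
  also have "\<dots> \<le> ?C * (real m * ?C ^ m * \<eta>) + ?C ^ Suc m * \<eta>"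
    using one_le_power[OF C, of "Suc m"] assms(2) mult_right_mono[of 1 "?C ^ Suc m" \<eta>] by simp
  also have "\<dots> = real (Suc m) * ?C ^ Suc m * \<eta>"
    by (simp add: algebra_simps)
  finally show ?case .
qed

section \<open>The vectors \<open>\<theta>\<close> and the products \<open>Psi_prod\<close>\<close>

lemma theta_1: "\<theta> 1 = \<psi> 1"
  by (simp add: theta_vec_def mat_prod_list_Nil)

lemma theta_Suc:
  assumes "n \<ge> 1"
  shows "\<theta> (Suc n) = cadjoint (M (Suc n)) *v \<theta> n"
  using assms by (simp add: theta_vec_def mat_prod_list_Cons matrix_vector_mul_assoc)

lemma cinner_S_theta:
  assumes "n \<ge> 1"
  shows "cinner S (\<theta> n) = 1"
  using assms
proof (induction n rule: dec_induct)
  case base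
  then show ?case
    using theta_1 cinner_S_psi by simp
next
  case (step n)
  then show ?case
    by (simp add: theta_Suc cinner_S_M_adjoint)
qed

lemma Psi_Suc: "Psi_prod M (Suc n) = Psi_prod M n ** M (Suc n)"
  by (simp add: Psi_prod_def mat_prod_list_snoc)

lemma Psi_contraction: "N (Psi_prod M n *v x) \<le> N x"
proof (induction n arbitrary: x)
  case 0
  then show ?case
    by (simp add: Psi_prod_def mat_prod_list_Nil)
next
  case (Suc n)
  then show ?case
    using contraction[of "Suc n" x]
    by (simp add: Psi_Suc flip: matrix_vector_mul_assoc) (meson order_trans)
qed

text \<open>The first factor, absent from \<open>\<theta>\<close>, may be inserted because the
  adjoint of \<open>M 1\<close> fixes \<open>\<psi> 1\<close>. This bounds \<open>\<theta>\<close>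
  uniformly, as \<open>Psi_prod M n\<close> is an \<open>N\<close>-contraction.\<close>

lemma theta_eq_Psi_adjoint:
  assumes "n \<ge> 1"
  shows "\<theta> n = cadjoint (Psi_prod M n) *v \<psi> 1"
  using assms
proof (induction n rule: dec_induct)
  case base
  then show ?case
    using theta_1 M_adjoint_psi[of 1] by (simp add: Psi_prod_def mat_prod_list_Nil mat_prod_list_Cons)
next
  case (step n)
  then show ?case
    by (simp add: theta_Suc Psi_Suc cadjoint_mult matrix_vector_mul_assoc)
qed

lemma norm_theta_le:
  assumes "n \<ge> 1"
  shows "norm (\<theta> n) \<le> K * norm (\<psi> 1)"
  unfolding theta_eq_Psi_adjoint[OF assms]
  by (intro norm_cadjoint_mult_vec_le K Psi_contraction)

lemma Psi_eq_ketbra_theta: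
  assumes "n \<ge> 1"
  shows "Psi_prod M n = ketbra S (\<theta> n) + mat_prod_list (map MQ [1..<Suc n])"
  using assms
proof (induction n rule: dec_induct)
  case base
  have "M 1 *v x = (ketbra S (\<psi> 1) + MQ 1) *v x" for x
    by (simp add: MQ_mult_vec ketbra_mult_vec matrix_vector_mult_add_rdistrib)
  then show ?case
    using theta_1 by (simp add: Psi_prod_def mat_prod_list_Nil mat_prod_list_Cons matrix_eq)
next
  case (step n)
  let ?R = "\<lambda>n. mat_prod_list (map MQ [1..<Suc n])"
  have snoc: "?R m = mat_prod_list (map MQ [1..<m]) ** MQ m" if "m \<ge> 1" for m
    using that by (simp add: upt_Suc_append mat_prod_list_snoc)
  \<comment> \<open>As \<open>n \<ge> 1\<close>, the product has a last factor \<open>MQ n\<close>,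
    which annihilates \<open>S\<close>.\<close>
  have RS: "?R n *v S = 0"
    using step.hyps by (simp only: snoc MQ_S flip: matrix_vector_mul_assoc) simp
  \<comment> \<open>\<open>M\<close> and \<open>MQ\<close> differ by a multiple of \<open>S\<close>,
    which the preceding product kills.\<close>
  have R: "?R n *v (M (Suc n) *v x) = ?R (Suc n) *v x" for x
  proof -
    have "?R (Suc n) *v x = ?R n *v (MQ (Suc n) *v x)"
      using snoc[of "Suc n"] by (simp add: matrix_vector_mul_assoc del: upt_Suc)
    also have "\<dots> = ?R n *v (M (Suc n) *v x) - cinner (\<psi> (Suc n)) x *s (?R n *v S)"
      by (simp only: MQ_mult_vec[of "Suc n"] matrix_vector_mult_diff_distrib
          vector_scalar_commute)
    finally show ?thesis
      by (simp only: RS) simp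
  qed
  have "Psi_prod M (Suc n) *v x = (ketbra S (\<theta> (Suc n)) + ?R (Suc n)) *v x" for x
  proof -
    have "Psi_prod M (Suc n) *v x = Psi_prod M n *v (M (Suc n) *v x)"
      by (simp add: Psi_Suc matrix_vector_mul_assoc)
    also have "\<dots> = cinner (\<theta> n) (M (Suc n) *v x) *s S + ?R n *v (M (Suc n) *v x)"
      unfolding step.IH by (simp add: matrix_vector_mult_add_rdistrib ketbra_mult_vec)
    also have "\<dots> = (ketbra S (\<theta> (Suc n)) + ?R (Suc n)) *v x"
      unfolding R using step.hyps
      by (simp add: matrix_vector_mult_add_rdistrib ketbra_mult_vec theta_Suc cinner_cadjoint)
    finally show ?thesis .
  qed
  then show ?case
    by (simp only: matrix_eq) blast
qed

lemma cinner_S_psi_limit: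
  assumes "\<psi> \<longlonglongrightarrow> l"
  shows "cinner S l = 1"
proof -
  have "eventually (\<lambda>n. cinner S (\<psi> n) = 1) sequentially"
    using eventually_ge_at_top[of 1] by eventually_elim (rule cinner_S_psi)
  then have "(\<lambda>n. cinner S (\<psi> n)) \<longlonglongrightarrow> 1"
    by (rule tendsto_eventually)
  then show ?thesis
    using tendsto_cinner_right[OF assms] LIMSEQ_unique by blast
qed

lemma cinner_S_theta_limit:
  assumes "\<theta> \<longlonglongrightarrow> l"
  shows "cinner S l = 1"
proof -
  have "eventually (\<lambda>n. cinner S (\<theta> n) = 1) sequentially"
    using eventually_ge_at_top[of 1] by eventually_elim (rule cinner_S_theta)
  then have "(\<lambda>n. cinner S (\<theta> n)) \<longlonglongrightarrow> 1"
    by (rule tendsto_eventually)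
  then show ?thesis
    using tendsto_cinner_right[OF assms] LIMSEQ_unique by blast
qed

end

section \<open>Convergence under uniform decay of the products of \<open>MQ\<close>\<close>

locale quasi_contractive_family = contractive_family +
  assumes MQ_products: "(\<lambda>n. SUP js \<in> {js. length js = n \<and> set js \<subseteq> {1..}}.
      ereal (onorm ((*v) (mat_prod_list (map (MQ_mat M S) js))))) \<longlonglongrightarrow> 0"
begin

text \<open>The \<open>ereal\<close> supremum bounds every word of its length, so one threshold
  serves all sufficiently long words, whatever their indices.\<close>

lemma MQ_products_eventually_less:
  assumes "\<epsilon> > 0"
  obtains n0 where "\<And>js. length js \<ge> n0 \<Longrightarrow> set js \<subseteq> {1..} \<Longrightarrow>
    onorm ((*v) (mat_prod_list (map MQ js))) < \<epsilon>"
proof -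
  obtain n0 where n0: "\<And>n. n \<ge> n0 \<Longrightarrow> (SUP js \<in> {js. length js = n \<and> set js \<subseteq> {1..}}.
      ereal (onorm ((*v) (mat_prod_list (map MQ js))))) < ereal \<epsilon>"
    using order_tendstoD(2)[OF MQ_products, of "ereal \<epsilon>"] assms
    by (auto simp: eventually_sequentially)
  have "onorm ((*v) (mat_prod_list (map MQ js))) < \<epsilon>"
    if "length js \<ge> n0" "set js \<subseteq> {1..}" for js
  proof -
    have "ereal (onorm ((*v) (mat_prod_list (map MQ js)))) \<le>
        (SUP js' \<in> {js'. length js' = length js \<and> set js' \<subseteq> {1..}}.
          ereal (onorm ((*v) (mat_prod_list (map MQ js')))))"
      using that by (intro SUP_upper) auto
    also have "\<dots> < ereal \<epsilon>"
      using that by (intro n0)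
    finally show ?thesis by simp
  qed
  then show ?thesis using that by blast
qed

lemma perturbed_halving:
  assumes m: "\<And>js. length js \<ge> m \<Longrightarrow> set js \<subseteq> {1..} \<Longrightarrow>
      onorm ((*v) (mat_prod_list (map MQ js))) < 1/2"
    and u: "\<And>k. j k \<ge> 1" "0 \<le> \<eta>"
      "\<And>k. u (Suc k) = cadjoint (MQ (j k)) *v u k + e k" "\<And>k. norm (e k) \<le> \<eta>"
  shows "norm (u m) \<le> 1/2 * norm (u 0) + real (Suc m) * (2 * K + 1) ^ m * \<eta>"
proof -
  let ?P = "mat_prod_list (map MQ (map j [0..<m]))"
  have "onorm ((*v) ?P) < 1/2"
    using u(1) by (intro m) auto
  then have "norm (?P *v x) \<le> 1/2 * norm x" for x
    using norm_mult_vec_le_onorm[of ?P x] mult_right_mono[of "onorm ((*v) ?P)" "1/2" "norm x"]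
    by (meson less_imp_le norm_ge_zero order_trans)
  then have "norm (cadjoint ?P *v u 0) \<le> 1/2 * norm (u 0)"
    by (rule norm_cadjoint_mult_vec_le)
  moreover have "norm (u m - cadjoint ?P *v u 0) \<le> real m * (2 * K + 1) ^ m * \<eta>"
    using u by (rule perturbed_product)
  \<comment> \<open>Passing from \<open>m\<close> to \<open>Suc m\<close> makes the coefficient
    visibly positive, so that one can divide by it.\<close>
  moreover have "\<dots> \<le> real (Suc m) * (2 * K + 1) ^ m * \<eta>"
    using K(1) u(2) by (intro mult_right_mono) auto
  moreover have "norm (u m) \<le> norm (cadjoint ?P *v u 0) + norm (u m - cadjoint ?P *v u 0)"
    by (rule norm_triangle_sub)
  ultimately show ?thesis
    by linarith
qed

lemma theta_tendsto_psi_limit: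
  assumes lim: "\<psi> \<longlonglongrightarrow> l"
  shows "\<theta> \<longlonglongrightarrow> l"
proof -
  define v where "v n = \<theta> n - l" for n
  define e where "e n = cadjoint (M (Suc n)) *v l - l" for n
  have Sv: "cinner S (v n) = 0" if "n \<ge> 1" for n
    using that by (simp add: v_def cinner_diff_right cinner_S_theta cinner_S_psi_limit[OF lim])
  \<comment> \<open>Since \<open>v n\<close> is orthogonal to \<open>S\<close>, the adjoint of
    \<open>M\<close> may be replaced by that of \<open>MQ\<close>.\<close>
  have rec: "v (Suc n) = cadjoint (MQ (Suc n)) *v v n + e n" if "n \<ge> 1" for n
    using that by (simp add: MQ_adjoint_mult_vec Sv)
      (simp add: v_def e_def theta_Suc matrix_vector_mult_diff_distrib)
  have e_le: "norm (e n) \<le> (K + 1) * norm (l - \<psi> (Suc n))" for n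
  proof -
    \<comment> \<open>Subtracting \<open>\<psi> (Suc n)\<close>, which is fixed by the adjoint of
      \<open>M (Suc n)\<close>, leaves \<open>e n\<close> unchanged and exposes a null
      sequence.\<close>
    have "e n = cadjoint (M (Suc n)) *v (l - \<psi> (Suc n)) - (l - \<psi> (Suc n))"
      using M_adjoint_psi[of "Suc n"] by (simp add: e_def matrix_vector_mult_diff_distrib)
    then have "norm (e n) \<le> norm (cadjoint (M (Suc n)) *v (l - \<psi> (Suc n))) + norm (l - \<psi> (Suc n))"
      by (metis norm_triangle_ineq4)
    then show ?thesis
      using norm_M_adjoint_le[of "Suc n" "l - \<psi> (Suc n)"] by (simp add: algebra_simps)
  qed
  have e: "e \<longlonglongrightarrow> 0"
  proof (rule Lim_null_comparison)
    show "eventually (\<lambda>n. norm (e n) \<le> (K + 1) * norm (l - \<psi> (Suc n))) sequentially"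
      by (intro always_eventually allI e_le)
    have "(\<lambda>n. (K + 1) * norm (l - \<psi> (Suc n))) \<longlonglongrightarrow> (K + 1) * norm (l - l)"
      by (intro tendsto_intros LIMSEQ_Suc lim)
    then show "(\<lambda>n. (K + 1) * norm (l - \<psi> (Suc n))) \<longlonglongrightarrow> 0"
      by simp
  qed
  obtain m where m: "\<And>js. length js \<ge> m \<Longrightarrow> set js \<subseteq> {1..} \<Longrightarrow>
      onorm ((*v) (mat_prod_list (map MQ js))) < 1/2"
    using MQ_products_eventually_less[of "1/2"] by auto
  \<comment> \<open>\<open>D\<close> is the error amplification over a block of length
    \<open>m\<close>; errors below \<open>\<eta> / D\<close> contribute at most
    \<open>\<eta>\<close>.\<close>
  define D where "D = real (Suc m) * (2 * K + 1) ^ m"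
  have "D > 0"
    using K(1) by (simp add: D_def)
  have "(\<lambda>n. norm (v n)) \<longlonglongrightarrow> 0"
  proof (rule eventually_halving_tendsto_0)
    show "norm (v n) \<le> K * norm (\<psi> 1) + norm l" if "n \<ge> 1" for n
      unfolding v_def using norm_triangle_ineq4[of "\<theta> n" l] norm_theta_le[OF that] by linarith
    fix \<eta> :: real
    assume "\<eta> > 0"
    then have "\<eta> / D > 0"
      using \<open>D > 0\<close> by simp
    then obtain n0 where n0: "\<And>n. n \<ge> n0 \<Longrightarrow> norm (e n) < \<eta> / D"
      using LIMSEQ_D[OF e] by auto
    have "norm (v (n + m)) \<le> 1/2 * norm (v n) + \<eta>" if n: "n \<ge> max n0 1" for n
    proof -
      have "norm (v (n + m)) \<le> 1/2 * norm (v (n + 0)) + real (Suc m) * (2 * K + 1) ^ m * (\<eta> / D)"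
      \<comment> \<open>The block starts at \<open>n\<close>; passing from \<open>v (n + k)\<close>
        to its successor uses the matrix with index \<open>Suc (n + k)\<close>.\<close>
      proof (rule perturbed_halving[where j = "\<lambda>k. Suc (n + k)" and e = "\<lambda>k. e (n + k)"
            and u = "\<lambda>k. v (n + k)"])
        show "onorm ((*v) (mat_prod_list (map MQ js))) < 1/2"
          if "length js \<ge> m" "set js \<subseteq> {1..}" for js
          using that by (rule m)
        show "v (n + Suc k) = cadjoint (MQ (Suc (n + k))) *v v (n + k) + e (n + k)" for k
          using rec[of "n + k"] n by simp
        show "norm (e (n + k)) \<le> \<eta> / D" for k
          using n0[of "n + k"] n by simp
      qed (use \<open>\<eta> / D > 0\<close> in simp_all)
      then show ?thesis
        unfolding D_def[symmetric] using \<open>D > 0\<close> by simp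
    qed
    then show "\<exists>n0. \<forall>n\<ge>n0. norm (v (n + m)) \<le> 1/2 * norm (v n) + \<eta>"
      by blast
  qed simp
  then have "(\<lambda>n. \<theta> n - l) \<longlonglongrightarrow> 0"
    unfolding v_def by (rule tendsto_norm_zero_cancel)
  then show ?thesis
    by (rule LIM_zero_cancel)
qed

lemma psi_tendsto_theta_limit:
  assumes lim: "\<theta> \<longlonglongrightarrow> l"
  shows "\<psi> \<longlonglongrightarrow> l"
proof -
  define v where "v n = l - \<psi> n" for n
  define e where "e n = l - cadjoint (M n) *v l" for n
  have fixpoint: "v n = cadjoint (MQ n) *v v n + e n" if "n \<ge> 1" for n
    using that
    by (simp add: MQ_adjoint_mult_vec v_def e_def cinner_diff_right cinner_S_psi
        cinner_S_theta_limit[OF lim] matrix_vector_mult_diff_distrib M_adjoint_psi)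
  obtain m where m: "\<And>js. length js \<ge> m \<Longrightarrow> set js \<subseteq> {1..} \<Longrightarrow>
      onorm ((*v) (mat_prod_list (map MQ js))) < 1/2"
    using MQ_products_eventually_less[of "1/2"] by auto
  define D where "D = real (Suc m) * (2 * K + 1) ^ m"
  have "D > 0"
    using K(1) by (simp add: D_def)
  have v_le: "norm (v n) \<le> 2 * D * norm (e n)" if "n \<ge> 1" for n
  proof -
    \<comment> \<open>By \<open>fixpoint\<close>, the constant sequence \<open>v n\<close> solves
      the recursion with constant index \<open>n\<close>. Both ends of the block are then
      \<open>v n\<close>, and its half can be absorbed on the left.\<close>
    have "norm (v n) \<le> 1/2 * norm (v n) + D * norm (e n)"
      unfolding D_def
      using perturbed_halving[OF m, where j = "\<lambda>_. n" and \<eta> = "norm (e n)"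
          and u = "\<lambda>_. v n" and e = "\<lambda>_. e n"] that
      by (simp add: fixpoint[OF that, symmetric])
    then show ?thesis by simp
  qed
  have e_le: "norm (e (Suc n)) \<le> norm (l - \<theta> (Suc n)) + K * norm (\<theta> n - l)" if "n \<ge> 1" for n
  proof -
    \<comment> \<open>Insert \<open>\<theta> (Suc n)\<close>, the image of \<open>\<theta> n\<close>
      under the adjoint; both differences are null.\<close>
    have "e (Suc n) = (l - \<theta> (Suc n)) + cadjoint (M (Suc n)) *v (\<theta> n - l)"
      using that by (simp add: e_def theta_Suc matrix_vector_mult_diff_distrib)
    also have "norm \<dots> \<le> norm (l - \<theta> (Suc n)) + norm (cadjoint (M (Suc n)) *v (\<theta> n - l))"
      by (rule norm_triangle_ineq)
    also have "\<dots> \<le> norm (l - \<theta> (Suc n)) + K * norm (\<theta> n - l)"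
      by (intro add_left_mono norm_M_adjoint_le) simp
    finally show ?thesis .
  qed
  have "(\<lambda>n. v (Suc n)) \<longlonglongrightarrow> 0"
  proof (rule Lim_null_comparison)
    show "eventually (\<lambda>n. norm (v (Suc n)) \<le>
        2 * D * (norm (l - \<theta> (Suc n)) + K * norm (\<theta> n - l))) sequentially"
      using eventually_ge_at_top[of 1]
    proof eventually_elim
      case (elim n)
      then show ?case
        using v_le[of "Suc n"] mult_left_mono[OF e_le, of n "2 * D"] \<open>D > 0\<close> by linarith
    qed
    have "(\<lambda>n. 2 * D * (norm (l - \<theta> (Suc n)) + K * norm (\<theta> n - l)))
        \<longlonglongrightarrow> 2 * D * (norm (l - l) + K * norm (l - l))"
      by (intro tendsto_intros LIMSEQ_Suc lim)
    then show "(\<lambda>n. 2 * D * (norm (l - \<theta> (Suc n)) + K * norm (\<theta> n - l))) \<longlonglongrightarrow> 0"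
      by simp
  qed
  then have "v \<longlonglongrightarrow> 0"
    by (rule LIMSEQ_imp_Suc)
  then have "(\<lambda>n. l - v n) \<longlonglongrightarrow> l - 0"
    by (intro tendsto_intros)
  then show ?thesis
    by (simp add: v_def)
qed

text \<open>The remainder in \<open>Psi_eq_ketbra_theta\<close> is a word of length \<open>n\<close>
  in the \<open>MQ\<close>; its operator norm, hence each entry, tends to 0.\<close>

lemma Psi_tendsto:
  assumes "\<psi> \<longlonglongrightarrow> l"
  shows "Psi_prod M \<longlonglongrightarrow> ketbra S l"
proof -
  let ?R = "\<lambda>n. mat_prod_list (map MQ [1..<Suc n])"
  have "(\<lambda>n. ?R n $ i $ j) \<longlonglongrightarrow> 0" for i j
  proof (rule LIMSEQ_I)
    fix r :: real
    assume "r > 0"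
    then obtain n0 where n0: "\<And>js. length js \<ge> n0 \<Longrightarrow> set js \<subseteq> {1..} \<Longrightarrow>
        onorm ((*v) (mat_prod_list (map MQ js))) < r"
      using MQ_products_eventually_less by blast
    have "norm (?R n $ i $ j - 0) < r" if "n \<ge> n0" for n
    proof -
      have "norm (?R n $ i $ j - 0) \<le> onorm ((*v) (?R n))"
        unfolding diff_zero by (rule cmod_entry_le_onorm)
      also have "\<dots> < r"
        using that by (intro n0) (auto simp del: upt_Suc)
      finally show ?thesis .
    qed
    then show "\<exists>n0. \<forall>n\<ge>n0. norm (?R n $ i $ j - 0) < r"
      by blast
  qed
  then have "?R \<longlonglongrightarrow> 0"
    by (intro vec_tendstoI) (simp del: upt_Suc)
  then have "(\<lambda>n. ketbra S (\<theta> n) + ?R n) \<longlonglongrightarrow> ketbra S l + 0"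
    by (intro tendsto_add tendsto_ketbra theta_tendsto_psi_limit assms)
  moreover have "eventually (\<lambda>n. ketbra S (\<theta> n) + ?R n = Psi_prod M n) sequentially"
    using eventually_ge_at_top[of 1] by eventually_elim (rule Psi_eq_ketbra_theta[symmetric])
  ultimately show ?thesis
    by (simp add: tendsto_cong)
qed

text \<open>Squaring multiplies by \<open>cinner l S\<close>, which is 1 because the normalisation
  of the \<open>\<psi>\<close> passes to the limit.\<close>

lemma ketbra_limit_idempotent:
  assumes "\<psi> \<longlonglongrightarrow> l"
  shows "ketbra S l ** ketbra S l = ketbra S l"
proof -
  have "cinner l S = 1"
    using cinner_S_psi_limit[OF assms] cinner_commute[of l S] by simp
  then show ?thesis
    by (simp add: matrix_eq ketbra_mult_vec cinner_scale_right flip: matrix_vector_mul_assoc)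
qed

end

theorem proposition5:
  fixes M :: "nat \<Rightarrow> complex ^ 'd ^ 'd" and S :: "complex ^ 'd" and N :: "complex ^ 'd \<Rightarrow> real"
  assumes "is_complex_norm N"
    and "\<And>j x. j \<ge> 1 \<Longrightarrow> N (M j *v x) \<le> N x"
    and "norm S = 1"
    and "\<And>j. j \<ge> 1 \<Longrightarrow> M j *v S = S"
    and "(\<lambda>n. SUP js \<in> {js. length js = n \<and> set js \<subseteq> {1..}}.
            ereal (onorm ((*v) (mat_prod_list (map (MQ_mat M S) js))))) \<longlonglongrightarrow> 0"
  shows "(convergent (theta_vec M S) \<longleftrightarrow> convergent (psi_vec M S)) \<and>
    (\<forall>\<psi>. psi_vec M S \<longlonglongrightarrow> \<psi> \<longrightarrow>
       theta_vec M S \<longlonglongrightarrow> \<psi> \<and>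
       Psi_prod M \<longlonglongrightarrow> ketbra S \<psi> \<and>
       ketbra S \<psi> ** ketbra S \<psi> = ketbra S \<psi>)"
proof -
  interpret quasi_contractive_family M S N
    by (intro quasi_contractive_family.intro contractive_family.intro
        quasi_contractive_family_axioms.intro assms)
  show ?thesis
    using theta_tendsto_psi_limit psi_tendsto_theta_limit Psi_tendsto ketbra_limit_idempotent
    unfolding convergent_def by blast
qed

end
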